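(* Let $(K,<)$ be an ordered field and let $v$ be a convex valuation on $K$. Suppose that at least one of the following holds: (i) $vK$ is discretely ordered, i.e., admits a least positive element. (ii) $vK$ is not closed in its divisible hull. (iii) $Kv$ is not closed in its real closure. Then $v$ is $\mathcal{L}_{\mathrm{or}}$-definable in $(K,<)$. Moreover, in the cases (i) and (ii), $v$ is definable by an $\mathcal{L}_{\mathrm{or}}$-formula using only one parameter.
   Context: $\mathcal{L}_{\mathrm{or}}=\{+,-,\cdot,0,1,<\}$ is the language of ordered rings. "Definable" means first-order definable with parameters; a valuation $v$ is called definable if its valuation ring $\mathcal{O}_v\subseteq K$ is a definable set. For a valuation $v$ on $K$, $vK$ denotes the (additively written, ordered abelian) value group and $Kv$ the residue field. The valuation $v$ is convex (with respect to $<$) if $\mathcal{O}_v$ is a convex subset of $(K,<)$; then $<$ induces an ordering on $Kv$, and the real closure of $Kv$ is taken with respect to this induced ordering. The divisible hull of $vK$ carries the unique group ordering extending that of $vK$. "Closed" refers to the order topology on the divisible hull, respectively on the real closure. *)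

theory Defs
  imports "HOL-Algebra.Algebraic_Closure_Type" "HOL-Algebra.QuotRing"
begin

section \<open>First-order formulas in the language of ordered rings\<close>

datatype or_term =
    Var nat
  | Zero
  | One
  | Plus or_term or_term
  | Minus or_term or_term
  | Times or_term or_term

datatype or_formula =
    Equal or_term or_term
  | Less or_term or_term
  | Neg or_formula
  | Conj or_formula or_formula
  | Exists nat or_formula

primrec term_vars :: "or_term \<Rightarrow> nat set" where
  "term_vars (Var i) = {i}"
| "term_vars Zero = {}"
| "term_vars One = {}"
| "term_vars (Plus s t) = term_vars s \<union> term_vars t"
| "term_vars (Minus s t) = term_vars s \<union> term_vars t"
| "term_vars (Times s t) = term_vars s \<union> term_vars t"

primrec free_vars :: "or_formula \<Rightarrow> nat set" where
  "free_vars (Equal s t) = term_vars s \<union> term_vars t"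
| "free_vars (Less s t) = term_vars s \<union> term_vars t"
| "free_vars (Neg \<phi>) = free_vars \<phi>"
| "free_vars (Conj \<phi> \<psi>) = free_vars \<phi> \<union> free_vars \<psi>"
| "free_vars (Exists i \<phi>) = free_vars \<phi> - {i}"

primrec term_value :: "(nat \<Rightarrow> 'a::linordered_field) \<Rightarrow> or_term \<Rightarrow> 'a" where
  "term_value e (Var i) = e i"
| "term_value e Zero = 0"
| "term_value e One = 1"
| "term_value e (Plus s t) = term_value e s + term_value e t"
| "term_value e (Minus s t) = term_value e s - term_value e t"
| "term_value e (Times s t) = term_value e s * term_value e t"

primrec satisfies :: "(nat \<Rightarrow> 'a::linordered_field) \<Rightarrow> or_formula \<Rightarrow> bool" where
  "satisfies e (Equal s t) \<longleftrightarrow> term_value e s = term_value e t"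
| "satisfies e (Less s t) \<longleftrightarrow> term_value e s < term_value e t"
| "satisfies e (Neg \<phi>) \<longleftrightarrow> \<not> satisfies e \<phi>"
| "satisfies e (Conj \<phi> \<psi>) \<longleftrightarrow> satisfies e \<phi> \<and> satisfies e \<psi>"
| "satisfies e (Exists i \<phi>) \<longleftrightarrow> (\<exists>a. satisfies (e(i := a)) \<phi>)"

text \<open>Variable \<open>0\<close> stands for the element of the defined set, the variables
  \<open>1, \<dots>, n\<close> for the parameters \<open>c 1, \<dots>, c n\<close>.\<close>

definition definable_with_params :: "nat \<Rightarrow> 'a::linordered_field set \<Rightarrow> bool" where
  "definable_with_params n S \<longleftrightarrow>
     (\<exists>\<phi> c. free_vars \<phi> \<subseteq> {0..n} \<and> S = {x. satisfies (c(0 := x)) \<phi>})"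

definition definable :: "'a::linordered_field set \<Rightarrow> bool" where
  "definable S \<longleftrightarrow> (\<exists>n. definable_with_params n S)"


section \<open>Valuations\<close>

text \<open>The conventional value \<open>v 0 = \<infinity>\<close> is not represented: only the
  restriction of \<open>v\<close> to the nonzero elements is used, and the conditions below treat \<open>0\<close>
  separately. The codomain \<open>'g\<close> may be larger than the value group.\<close>

definition is_valuation :: "('a::field \<Rightarrow> 'g::linordered_ab_group_add) \<Rightarrow> bool" where
  "is_valuation v \<longleftrightarrow>
     (\<forall>x y. x \<noteq> 0 \<longrightarrow> y \<noteq> 0 \<longrightarrow> v (x * y) = v x + v y) \<and>
     (\<forall>x y. x \<noteq> 0 \<longrightarrow> y \<noteq> 0 \<longrightarrow> x + y \<noteq> 0 \<longrightarrow> min (v x) (v y) \<le> v (x + y))"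

definition value_group :: "('a::field \<Rightarrow> 'g::linordered_ab_group_add) \<Rightarrow> 'g set" where
  "value_group v = v ` (- {0})"

definition valuation_ring :: "('a::field \<Rightarrow> 'g::linordered_ab_group_add) \<Rightarrow> 'a set" where
  "valuation_ring v = {x. x = 0 \<or> 0 \<le> v x}"

definition valuation_ideal :: "('a::field \<Rightarrow> 'g::linordered_ab_group_add) \<Rightarrow> 'a set" where
  "valuation_ideal v = {x. x = 0 \<or> 0 < v x}"

definition residue_field :: "('a::field \<Rightarrow> 'g::linordered_ab_group_add) \<Rightarrow> 'a set ring" where
  "residue_field v = ring_of_type_algebra\<lparr>carrier := valuation_ring v\<rparr> Quot valuation_ideal v"

definition order_convex :: "'a::linorder set \<Rightarrow> bool" where
  "order_convex S \<longleftrightarrow> (\<forall>x\<in>S. \<forall>y\<in>S. {x..y} \<subseteq> S)"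

definition convex_valuation ::
    "('a::linordered_field \<Rightarrow> 'g::linordered_ab_group_add) \<Rightarrow> bool" where
  "convex_valuation v \<longleftrightarrow> is_valuation v \<and> order_convex (valuation_ring v)"

text \<open>The ordering induced on the residue field, whose elements are cosets of the valuation
  ideal. If \<open>v\<close> is convex then distinct cosets are convex and disjoint, so the choice of the
  representatives does not matter.\<close>

definition residue_less :: "'a::linordered_field set \<Rightarrow> 'a set \<Rightarrow> bool" where
  "residue_less A B \<longleftrightarrow> A \<noteq> B \<and> (\<exists>x\<in>A. \<exists>y\<in>B. x < y)"


section \<open>Divisible hulls, real closures\<close>

definition discretely_ordered :: "'g::linordered_ab_group_add set \<Rightarrow> bool" where
  "discretely_ordered G \<longleftrightarrow> (\<exists>g\<in>G. 0 < g \<and> (\<forall>h\<in>G. 0 < h \<longrightarrow> g \<le> h))"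

text \<open>A divisible hull of the subgroup \<open>G\<close>, given as a type \<open>'d\<close> together with an embedding of
  ordered groups \<open>\<eta>\<close>. The sum over \<open>{..<n}\<close> is the \<open>n\<close>-fold multiple. Being unique up to an
  isomorphism of ordered groups over \<open>G\<close>, the divisible hull may be any such \<open>(\<eta>, 'd)\<close>.\<close>

definition is_divisible_hull ::
    "'g::linordered_ab_group_add set \<Rightarrow> ('g \<Rightarrow> 'd::linordered_ab_group_add) \<Rightarrow> bool" where
  "is_divisible_hull G \<eta> \<longleftrightarrow>
     (\<forall>g\<in>G. \<forall>h\<in>G. \<eta> (g + h) = \<eta> g + \<eta> h) \<and>
     strict_mono_on G \<eta> \<and>
     (\<forall>d::'d. \<forall>n>0. \<exists>e. (\<Sum>i<(n::nat). e) = d) \<and>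
     (\<forall>d::'d. \<exists>n>0. (\<Sum>i<(n::nat). d) \<in> \<eta> ` G)"

definition real_closed :: "'r::linordered_field itself \<Rightarrow> bool" where
  "real_closed _ \<longleftrightarrow>
     (\<forall>a::'r. 0 \<le> a \<longrightarrow> (\<exists>b. b ^ 2 = a)) \<and>
     (\<forall>p::'r Polynomial.poly. odd (Polynomial.degree p) \<longrightarrow> (\<exists>a. Polynomial.poly p a = 0))"

definition algebraic_over :: "'r::field set \<Rightarrow> 'r \<Rightarrow> bool" where
  "algebraic_over F a \<longleftrightarrow>
     (\<exists>p. p \<noteq> 0 \<and> (\<forall>i. Polynomial.coeff p i \<in> F) \<and> Polynomial.poly p a = 0)"

text \<open>A real closure of the field \<open>F\<close> with the strict ordering \<open>lt\<close>, again given as a type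
  \<open>'r\<close> with an embedding of ordered fields \<open>\<kappa>\<close>, and again unique up to isomorphism over \<open>F\<close>.\<close>

definition is_real_closure ::
    "'k ring \<Rightarrow> ('k \<Rightarrow> 'k \<Rightarrow> bool) \<Rightarrow> ('k \<Rightarrow> 'r::linordered_field) \<Rightarrow> bool" where
  "is_real_closure F lt \<kappa> \<longleftrightarrow>
     \<kappa> \<in> ring_hom F ring_of_type_algebra \<and>
     (\<forall>x\<in>carrier F. \<forall>y\<in>carrier F. lt x y \<longrightarrow> \<kappa> x < \<kappa> y) \<and>
     real_closed TYPE('r) \<and>
     (\<forall>a. algebraic_over (\<kappa> ` carrier F) a)"

end

theory Submission
  imports Defs
begin

text \<open>If \<open>v b\<close> is the least positive value, with \<open>0 < b\<close>, then the valuation ring is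
  \<open>{x. b * x\<^sup>2 < 1}\<close>. If \<open>\<gamma>\<close> is a limit of \<open>vK\<close> in the divisible hull but not in \<open>vK\<close>, and
  \<open>n\<gamma> = v a\<close>, then the positive elements of value above \<open>\<gamma>\<close> are those with \<open>x ^ n < a\<close>;
  multiplication by \<open>y\<close> maps this set into itself, up to signs, iff \<open>0 \<le> v y\<close>, since an element of
  negative value moves some value close to \<open>\<gamma>\<close> across \<open>\<gamma>\<close>. Similarly, if \<open>r\<close> is a limit of \<open>Kv\<close>
  in the real closure but not in \<open>Kv\<close>, then the cut of \<open>K\<close> at \<open>r\<close> is definable by lifting a
  polynomial that changes sign at \<open>r\<close>, and the translations preserving this cut are those by the
  elements of the valuation ideal, which determines the valuation ring.\<close>

lemma definable_with_paramsI:
  "free_vars \<phi> \<subseteq> {0..n} \<Longrightarrow> (\<And>x. satisfies (c(0 := x)) \<phi> \<longleftrightarrow> x \<in> S) \<Longrightarrow> definable_with_params n S"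
  unfolding definable_with_params_def by blast

section \<open>Convex valuations\<close>

locale convex_valued_field =
  fixes v :: "'a::linordered_field \<Rightarrow> 'g::linordered_ab_group_add"
  assumes convex: "convex_valuation v"
begin

abbreviation "\<O> \<equiv> valuation_ring v"
abbreviation "\<mm> \<equiv> valuation_ideal v"

lemma val_mult: "x \<noteq> 0 \<Longrightarrow> y \<noteq> 0 \<Longrightarrow> v (x * y) = v x + v y"
  using convex by (simp add: convex_valuation_def is_valuation_def)

lemma val_add: "x \<noteq> 0 \<Longrightarrow> y \<noteq> 0 \<Longrightarrow> x + y \<noteq> 0 \<Longrightarrow> min (v x) (v y) \<le> v (x + y)"
  using convex by (simp add: convex_valuation_def is_valuation_def)

lemma ring_convex: "x \<in> \<O> \<Longrightarrow> y \<in> \<O> \<Longrightarrow> x \<le> z \<Longrightarrow> z \<le> y \<Longrightarrow> z \<in> \<O>"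
  using convex by (force simp: convex_valuation_def order_convex_def)

lemma val_1 [simp]: "v 1 = 0"
  using val_mult[of 1 1] by simp

lemma val_minus [simp]: "v (- x) = v x"
proof (cases "x = 0")
  case False
  have "v (- 1) + v (- 1) = 0"
    using val_mult[of "- 1" "- 1"] by simp
  then have "v (- 1) = 0"
    by (simp add: double_zero)
  with False show ?thesis
    using val_mult[of "- 1" x] by simp
qed simp

lemma val_inverse: "x \<noteq> 0 \<Longrightarrow> v (inverse x) = - v x"
  using val_mult[of x "inverse x"] by (simp add: eq_neg_iff_add_eq_0 add.commute)

section \<open>Closure properties of the valuation ring and the valuation ideal\<close>

lemma ring_0 [simp]: "0 \<in> \<O>" and ring_1 [simp]: "1 \<in> \<O>"
  by (simp_all add: valuation_ring_def)

lemma ring_add: "x \<in> \<O> \<Longrightarrow> y \<in> \<O> \<Longrightarrow> x + y \<in> \<O>"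
  using val_add[of x y] by (cases "x = 0 \<or> y = 0 \<or> x + y = 0") (auto simp: valuation_ring_def min_def split: if_splits)

lemma ring_minus: "x \<in> \<O> \<Longrightarrow> - x \<in> \<O>"
  by (simp add: valuation_ring_def)

lemma ring_diff: "x \<in> \<O> \<Longrightarrow> y \<in> \<O> \<Longrightarrow> x - y \<in> \<O>"
  using ring_add[OF _ ring_minus, of x y] by simp

lemma ring_mult: "x \<in> \<O> \<Longrightarrow> y \<in> \<O> \<Longrightarrow> x * y \<in> \<O>"
  using val_mult[of x y] by (cases "x = 0 \<or> y = 0") (auto simp: valuation_ring_def)

lemma ring_power: "x \<in> \<O> \<Longrightarrow> x ^ n \<in> \<O>"
  by (induction n) (simp_all add: ring_mult)

lemma ring_sum: "(\<And>i. i \<in> A \<Longrightarrow> f i \<in> \<O>) \<Longrightarrow> sum f A \<in> \<O>"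
  by (induction A rule: infinite_finite_induct) (simp_all add: ring_add)

lemma ideal_in_ring: "x \<in> \<mm> \<Longrightarrow> x \<in> \<O>"
  by (auto simp: valuation_ring_def valuation_ideal_def)

lemma ideal_0 [simp]: "0 \<in> \<mm>"
  by (simp add: valuation_ideal_def)

lemma ideal_add: "x \<in> \<mm> \<Longrightarrow> y \<in> \<mm> \<Longrightarrow> x + y \<in> \<mm>"
  using val_add[of x y] by (cases "x = 0 \<or> y = 0 \<or> x + y = 0") (auto simp: valuation_ideal_def min_def split: if_splits)

lemma ideal_minus: "x \<in> \<mm> \<Longrightarrow> - x \<in> \<mm>"
  by (simp add: valuation_ideal_def)

lemma ideal_mult: "x \<in> \<O> \<Longrightarrow> y \<in> \<mm> \<Longrightarrow> x * y \<in> \<mm>"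
  using val_mult[of x y] by (cases "x = 0 \<or> y = 0") (auto simp: valuation_ring_def valuation_ideal_def add_nonneg_pos)

text \<open>The inverse of a nonzero \<open>z\<close> has value \<open>- v z\<close>, hence lies in
  \<open>\<mm>\<close> exactly when \<open>z\<close> is outside \<open>\<O>\<close>. This turns a
  first-order description of \<open>\<mm>\<close> into one of \<open>\<O>\<close>.\<close>

lemma mem_ring_iff_no_inverse: "z \<in> \<O> \<longleftrightarrow> \<not> (\<exists>y\<in>\<mm>. z * y = 1)"
proof (cases "z = 0")
  case False
  then have "z * y = 1 \<longleftrightarrow> y = inverse z" for y
    by (auto simp: field_simps)
  with False show ?thesis
    by (auto simp: valuation_ring_def valuation_ideal_def val_inverse)
qed simp

text \<open>By convexity the quotient \<open>x / y\<close>, lying between 0 and 1, belongs to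
  \<open>\<O>\<close>.\<close>

lemma val_antimono:
  assumes "0 < x" "x \<le> y"
  shows "v y \<le> v x"
proof -
  have "x / y \<in> \<O>"
    using assms by (intro ring_convex[OF ring_0 ring_1]) auto
  then have "0 \<le> v (x / y)"
    using assms by (simp add: valuation_ring_def)
  moreover have "v x = v (x / y) + v y"
    using assms val_mult[of "x / y" y] by simp
  ultimately show ?thesis
    by simp
qed

text \<open>Translates comparisons of values into inequalities that a formula can express.\<close>

lemma less_iff_val_less:
  assumes "0 < x" "0 < y" "v x \<noteq> v y"
  shows "x < y \<longleftrightarrow> v y < v x"
  using val_antimono[of x y] val_antimono[of y x] assms by force

lemma value_groupE:
  assumes "g \<in> value_group v"
  obtains b where "0 < b" "v b = g"
proof -
  obtain b where b: "b \<noteq> 0" "v b = g"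
    using assms by (auto simp: value_group_def)
  show ?thesis
    using b by (intro that[of "\<bar>b\<bar>"]) (auto simp: abs_if)
qed

lemma value_groupI: "x \<noteq> 0 \<Longrightarrow> v x \<in> value_group v"
  by (simp add: value_group_def)

section \<open>Conditions on the value group\<close>

text \<open>If \<open>0 \<le> v x\<close>, the factor \<open>b\<close> makes the value of
  \<open>b * (x * x)\<close> positive. Otherwise \<open>v x \<le> - g\<close>: one of the two copies
  of \<open>v x\<close> outweighs \<open>g\<close>, and the other keeps the value negative.\<close>

lemma definable_if_discrete:
  assumes "discretely_ordered (value_group v)"
  shows "definable_with_params 1 \<O>"
proof -
  obtain g where g: "g \<in> value_group v" "0 < g" "\<And>h. h \<in> value_group v \<Longrightarrow> 0 < h \<Longrightarrow> g \<le> h"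
    using assms by (auto simp: discretely_ordered_def)
  obtain b where b: "0 < b" "v b = g"
    using g(1) by (rule value_groupE)
  have iff: "x \<in> \<O> \<longleftrightarrow> b * (x * x) < 1" for x
  proof (cases "x = 0")
    case False
    have val: "v (b * (x * x)) = g + (v x + v x)"
      using False b by (simp add: val_mult)
    have pos: "0 < b * (x * x)"
      using False b by (auto simp: zero_less_mult_iff neq_iff)
    show ?thesis
    proof (cases "0 \<le> v x")
      case True
      then have "v 1 < v (b * (x * x))"
        using val g(2) by (simp add: add_pos_nonneg)
      then show ?thesis
        using True pos less_iff_val_less[of "b * (x * x)" 1] by (auto simp: valuation_ring_def)
    next
      case neg: False
      then have "g \<le> - v x"
        using False g(3)[of "v (inverse x)"] value_groupI[of "inverse x"]
        by (simp add: val_inverse)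
      then have "g + v x \<le> 0"
        using add_right_mono[of g "- v x" "v x"] by simp
      then have "v (b * (x * x)) < v 1"
        using val neg by (simp add: add.assoc[symmetric] add_nonpos_neg)
      then show ?thesis
        using neg False pos less_iff_val_less[of "b * (x * x)" 1] by (auto simp: valuation_ring_def)
    qed
  qed simp
  let ?\<phi> = "Less (Times (Var 1) (Times (Var 0) (Var 0))) One"
  show ?thesis
    by (rule definable_with_paramsI[of ?\<phi> _ "\<lambda>_. b"]) (simp_all add: iff)
qed

end

text \<open>Some point outside \<open>S\<close> has no open neighbourhood within the complement, so
  every open interval around it meets \<open>S\<close>. Ordered groups cover both the divisible hull
  and the real closure.\<close>

lemma not_closed_limit:
  fixes S :: "'b::{linordered_ab_group_add, linorder_topology} set"
  assumes "\<not> closed S"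
  obtains r where "r \<notin> S" "\<And>e. 0 < e \<Longrightarrow> \<exists>s\<in>S. r - e < s \<and> s < r + e"
proof -
  obtain r where r: "r \<notin> S" "\<And>T. open T \<Longrightarrow> r \<in> T \<Longrightarrow> \<not> T \<subseteq> - S"
    using assms unfolding closed_def by (subst (asm) open_subopen) auto
  have "\<exists>s\<in>S. r - e < s \<and> s < r + e" if "0 < e" for e
    using r(2)[of "{r - e<..<r + e}"] that by auto
  with r(1) show thesis
    by (rule that)
qed

primrec power_term :: "or_term \<Rightarrow> nat \<Rightarrow> or_term" where
  "power_term t 0 = One"
| "power_term t (Suc n) = Times t (power_term t n)"

lemma term_value_power_term [simp]: "term_value e (power_term t n) = term_value e t ^ n"
  by (induction n) simp_all

lemma term_vars_power_term: "term_vars (power_term t n) \<subseteq> term_vars t"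
  by (induction n) auto

context convex_valued_field
begin

text \<open>The exponent \<open>n\<close> is a fixed number built into the formula, so
  \<open>a\<close> is the only parameter.\<close>

lemma definable_if_value_group_not_closed:
  fixes \<eta> :: "'g \<Rightarrow> 'd::{linordered_ab_group_add, linorder_topology}"
  assumes hull: "is_divisible_hull (value_group v) \<eta>" and "\<not> closed (\<eta> ` value_group v)"
  shows "definable_with_params 1 \<O>"
proof -
  let ?w = "\<lambda>x. \<eta> (v x)"
  have w_mult: "?w (x * y) = ?w x + ?w y" if "x \<noteq> 0" "y \<noteq> 0" for x y
    using hull that by (simp add: val_mult is_divisible_hull_def value_groupI)
  have w_less: "?w x < ?w y \<longleftrightarrow> v x < v y" if "x \<noteq> 0" "y \<noteq> 0" for x y
    using hull that by (intro strict_mono_on_less) (auto simp: is_divisible_hull_def value_groupI)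
  have w_1: "?w 1 = 0"
    using w_mult[of 1 1] by simp
  have w_inverse: "?w (inverse x) = - ?w x" if "x \<noteq> 0" for x
    using w_mult[of x "inverse x"] w_1 that by (simp add: eq_neg_iff_add_eq_0 add.commute)
  have w_power: "?w (x ^ n) = (\<Sum>i<n. ?w x)" if "x \<noteq> 0" for x n
    using that w_1 by (induction n) (simp_all add: w_mult add.commute)
  obtain \<gamma> where \<gamma>: "\<gamma> \<notin> \<eta> ` value_group v"
    "\<And>e. 0 < e \<Longrightarrow> \<exists>s\<in>\<eta> ` value_group v. \<gamma> - e < s \<and> s < \<gamma> + e"
    using not_closed_limit[OF assms(2)] by blast
  \<comment> \<open>Although \<gamma> is not a value, some positive multiple of it is, and so the
    cut at \<gamma> can be tested against an element \<open>a\<close> of the field.\<close>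
  obtain n where n: "0 < n" "(\<Sum>i<(n::nat). \<gamma>) \<in> \<eta> ` value_group v"
    using hull unfolding is_divisible_hull_def by blast
  then obtain a where a: "0 < a" "?w a = (\<Sum>i<n. \<gamma>)"
    by (auto elim!: value_groupE)
  have multiple_less: "(\<Sum>i<n. c) < (\<Sum>i<n. d)" if "c < d" for c d :: 'd
    using n(1) that by (intro sum_strict_mono) (auto simp: lessThan_empty_iff)
  \<comment> \<open>Forming \<open>n\<close>-fold multiples is strictly monotone, and
    \<open>?w x = \<gamma>\<close> is impossible.\<close>
  have cut: "x ^ n < a \<longleftrightarrow> \<gamma> < ?w x" if "0 < x" for x
  proof (cases "\<gamma> < ?w x")
    case True
    then have "?w a < ?w (x ^ n)"
      using that multiple_less a by (simp add: w_power)
    then show ?thesis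
      using True that a w_less[of a "x ^ n"] less_iff_val_less[of "x ^ n" a] by simp
  next
    case False
    then have "?w x < \<gamma>"
      using \<gamma>(1) that value_groupI[of x] by (metis image_eqI less_irrefl linorder_neqE)
    then have "?w (x ^ n) < ?w a"
      using that multiple_less a by (simp add: w_power)
    then show ?thesis
      using False that a w_less[of "x ^ n" a] less_iff_val_less[of "x ^ n" a] by simp
  qed
  \<comment> \<open>The product \<open>y * x\<close> may be negative, so both signs are tested; one
    of them is \<open>\<bar>y\<bar> * x\<close>.\<close>
  let ?P = "\<lambda>y. \<forall>x. 0 < x \<and> x ^ n < a \<longrightarrow> (y * x) ^ n < a \<and> (- (y * x)) ^ n < a"
  have w_abs: "?w \<bar>x\<bar> = ?w x" for x
    by (simp add: abs_if)
  have ring_if: "y \<in> \<O>" if P: "?P y" for y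
  proof (rule ccontr)
    assume "y \<notin> \<O>"
    then have y: "y \<noteq> 0" "v y < 0"
      by (auto simp: valuation_ring_def)
    then have "?w y < 0"
      using w_less[of y 1] w_1 by simp
    \<comment> \<open>Here \<open>s\<close> is closer to \<gamma> than the size of
      \<open>?w y\<close>. If \<open>s\<close> were above \<gamma>, multiplication by
      \<open>\<bar>y\<bar>\<close> would push it below. If it is below, division by
      \<open>\<bar>y\<bar>\<close> lifts it above \<gamma>, and multiplying back must keep it
      there.\<close>
    then obtain s where s: "s \<in> \<eta> ` value_group v" "\<gamma> + ?w y < s" "s < \<gamma> - ?w y"
      using \<gamma>(2)[of "- ?w y"] by auto
    then obtain x where x: "0 < x" "s = ?w x"
      by (auto elim!: value_groupE)
    have absP: "(\<bar>y\<bar> * x) ^ n < a" if "0 < x" "x ^ n < a" for x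
      using P that by (cases "0 \<le> y") auto
    have shift: "\<gamma> < ?w y + ?w x" if "0 < x" "\<gamma> < ?w x" for x
      using absP[of x] that cut[of x] cut[of "\<bar>y\<bar> * x"] y by (simp add: w_mult w_abs)
    have "\<not> \<gamma> < ?w x"
      using shift[of x] x s by (auto simp: less_diff_eq algebra_simps)
    moreover have "\<gamma> < ?w (x * inverse \<bar>y\<bar>)"
      using x s y by (simp add: w_mult w_inverse w_abs less_diff_eq)
    then have "\<gamma> < ?w y + ?w (x * inverse \<bar>y\<bar>)"
      using x y by (intro shift) auto
    then have "\<gamma> < ?w x"
      using x y by (simp add: w_mult w_inverse w_abs)
    ultimately show False ..
  qed
  have if_ring: "?P y" if "y \<in> \<O>" for y
  proof (cases "y = 0")
    case True
    \<comment> \<open>Since \<open>0 < n\<close>, the power \<open>0 ^ n\<close> is 0 and not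
      1.\<close>
    then show ?thesis
      using a n by (simp add: power_0_left)
  next
    case False
    then have y: "0 \<le> ?w y"
      using that w_less[of y 1] w_1 by (auto simp: valuation_ring_def not_less[symmetric])
    have "(\<bar>y\<bar> * x) ^ n < a" if "0 < x" "x ^ n < a" for x
    proof -
      have "\<gamma> < ?w y + ?w x"
        using y that cut[of x] by (simp add: add_strict_increasing2)
      then show ?thesis
        using that False cut[of "\<bar>y\<bar> * x"] by (simp add: w_mult w_abs)
    qed
    \<comment> \<open>With this, the bound for \<open>\<bar>y\<bar> * x\<close> covers both signs,
      whatever the parity of \<open>n\<close>.\<close>
    moreover have "z ^ n \<le> \<bar>z\<bar> ^ n" for z :: 'a
      using abs_ge_self[of "z ^ n"] by (simp add: power_abs)
    ultimately show ?thesis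
      by (smt (verit, best) abs_minus_cancel abs_mult abs_of_pos order_le_less_trans)
  qed
  have iff: "y \<in> \<O> \<longleftrightarrow> ?P y" for y
    using ring_if if_ring by blast
  \<comment> \<open>Variable 0 is \<open>y\<close>, variable 1 is \<open>a\<close>, and variable 2
    is the quantified \<open>x\<close>. The formula denies the existence of a counterexample to
    \<open>?P y\<close>.\<close>
  let ?A = "\<lambda>t. Less (power_term t n) (Var 1)"
  let ?yx = "Times (Var 0) (Var 2)"
  let ?\<phi> = "Neg (Exists 2 (Conj (Conj (Less Zero (Var 2)) (?A (Var 2)))
    (Neg (Conj (?A ?yx) (?A (Minus Zero ?yx))))))"
  have "free_vars ?\<phi> \<subseteq> {0..1}"
    using term_vars_power_term[of "Var 2" n] term_vars_power_term[of ?yx n]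
      term_vars_power_term[of "Minus Zero ?yx" n] by auto
  moreover have "satisfies ((\<lambda>_. a)(0 := y)) ?\<phi> \<longleftrightarrow> y \<in> \<O>" for y
    unfolding iff by auto
  ultimately show ?thesis
    by (rule definable_with_paramsI)
qed

section \<open>The residue map\<close>

text \<open>Composing the coset map with \<kappa> gives a map on field elements, so that later
  arguments avoid the quotient ring. Monotonicity is only weak because elements of one coset have
  the same image.\<close>

lemma residue_map:
  assumes "is_real_closure (residue_field v) residue_less \<kappa>"
  obtains \<rho> :: "'a \<Rightarrow> 'r::linordered_field" where
    "\<rho> ` \<O> = \<kappa> ` carrier (residue_field v)" "\<rho> 1 = 1"
    "\<And>x y. x \<in> \<O> \<Longrightarrow> y \<in> \<O> \<Longrightarrow> \<rho> (x + y) = \<rho> x + \<rho> y"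
    "\<And>x y. x \<in> \<O> \<Longrightarrow> y \<in> \<O> \<Longrightarrow> \<rho> (x * y) = \<rho> x * \<rho> y"
    "\<And>x y. x \<in> \<O> \<Longrightarrow> y \<in> \<O> \<Longrightarrow> x \<le> y \<Longrightarrow> \<rho> x \<le> \<rho> y"
    "\<And>x. x \<in> \<O> \<Longrightarrow> \<rho> x = 0 \<longleftrightarrow> x \<in> \<mm>"
proof -
  define T where "T = (ring_of_type_algebra :: 'a ring)"
  define R where "R = T\<lparr>carrier := \<O>\<rparr>"
  have T_simps: "carrier T = UNIV" "\<And>x y. x \<oplus>\<^bsub>T\<^esub> y = x + y" "\<And>x y. x \<otimes>\<^bsub>T\<^esub> y = x * y"
    "\<zero>\<^bsub>T\<^esub> = 0" "\<one>\<^bsub>T\<^esub> = 1"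
    by (simp_all add: T_def ring_of_type_algebra_def)
  interpret T: ring T
    unfolding T_def by (rule ring_from_type_algebra)
  have T_minus: "\<ominus>\<^bsub>T\<^esub> x = - x" for x
    using T.minus_equality[of "- x" x] by (simp add: T_simps)
  have "subring \<O> T"
    by (rule T.subringI) (simp_all add: T_simps T_minus ring_minus ring_mult ring_add)
  then have "ring R"
    unfolding R_def by (rule T.subring_is_ring)
  then interpret R: ring R .
  have R_simps: "carrier R = \<O>" "\<And>x y. x \<oplus>\<^bsub>R\<^esub> y = x + y" "\<And>x y. x \<otimes>\<^bsub>R\<^esub> y = x * y"
    "\<zero>\<^bsub>R\<^esub> = 0" "\<one>\<^bsub>R\<^esub> = 1"
    by (simp_all add: R_def T_simps)
  have R_minus: "\<ominus>\<^bsub>R\<^esub> x = - x" if "x \<in> \<O>" for x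
    using R.minus_equality[of "- x" x] that by (simp add: R_simps ring_minus)
  have "subgroup \<mm> (add_monoid R)"
    by (rule R.add.subgroupI)
      (auto simp: R_simps R_minus ideal_in_ring ideal_add ideal_minus simp flip: a_inv_def
        intro: ideal_0)
  moreover have "a * x \<in> \<mm>" if "a \<in> \<mm>" "x \<in> \<O>" for a x
    using ideal_mult[OF that(2,1)] by (simp add: mult.commute)
  ultimately interpret I: ideal \<mm> R
    using \<open>ring R\<close> by (intro idealI) (simp_all add: R_simps ideal_mult)
  let ?C = "\<lambda>x. \<mm> +>\<^bsub>R\<^esub> x"
  let ?S = "ring_of_type_algebra :: 'r ring"
  have F: "residue_field v = R Quot \<mm>"
    by (simp add: residue_field_def R_def T_def)
  have \<kappa>: "\<kappa> \<in> ring_hom (R Quot \<mm>) ?S"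
    "\<And>A B. A \<in> carrier (R Quot \<mm>) \<Longrightarrow> B \<in> carrier (R Quot \<mm>) \<Longrightarrow> residue_less A B \<Longrightarrow> \<kappa> A < \<kappa> B"
    using assms by (simp_all add: is_real_closure_def F)
  have carrier: "carrier (R Quot \<mm>) = ?C ` \<O>"
    by (auto simp: FactRing_def A_RCOSETS_def' R_simps)
  have hom: "(\<lambda>x. \<kappa> (?C x)) \<in> ring_hom R ?S"
    using ring_hom_trans[OF I.rcos_ring_hom \<kappa>(1)] by (simp add: comp_def)
  have coset_mem: "x \<in> ?C y \<longleftrightarrow> x - y \<in> \<mm>" for x y
    by (force simp: a_r_coset_def' R_simps)
  have coset_eq: "?C x = ?C y \<longleftrightarrow> x - y \<in> \<mm>" if "x \<in> \<O>" "y \<in> \<O>" for x y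
    using I.a_repr_independence'[of x y] I.a_repr_independenceD[of x y] that coset_mem R_simps by auto
  \<comment> \<open>The elements \<open>x\<close> and \<open>y\<close> themselves are the
    representatives that \<open>residue_less\<close> asks for.\<close>
  have strict: "\<kappa> (?C x) < \<kappa> (?C y)" if "x \<in> \<O>" "y \<in> \<O>" "x < y" "x - y \<notin> \<mm>" for x y
  proof (rule \<kappa>(2))
    show "residue_less (?C x) (?C y)"
      using that coset_eq[of x y] coset_mem[of x x] coset_mem[of y y] unfolding residue_less_def by auto
  qed (use that carrier in auto)
  show thesis
  proof (rule that[of "\<lambda>x. \<kappa> (?C x)"])
    show "(\<lambda>x. \<kappa> (?C x)) ` \<O> = \<kappa> ` carrier (residue_field v)"
      by (simp add: F carrier image_image)
    show "\<kappa> (?C 1) = 1"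
      using ring_hom_one[OF hom] by (simp add: R_simps ring_of_type_algebra_def)
    show "\<kappa> (?C (x + y)) = \<kappa> (?C x) + \<kappa> (?C y)" if "x \<in> \<O>" "y \<in> \<O>" for x y
      using ring_hom_add[OF hom, of x y] that by (simp add: R_simps ring_of_type_algebra_def)
    then have zero: "\<kappa> (?C 0) = 0"
      by (metis add_cancel_left_left add_0 ring_0)
    show "\<kappa> (?C (x * y)) = \<kappa> (?C x) * \<kappa> (?C y)" if "x \<in> \<O>" "y \<in> \<O>" for x y
      using ring_hom_mult[OF hom, of x y] that by (simp add: R_simps ring_of_type_algebra_def)
    show "\<kappa> (?C x) \<le> \<kappa> (?C y)" if "x \<in> \<O>" "y \<in> \<O>" "x \<le> y" for x y
      using strict[of x y] coset_eq[of x y] that by (cases "x - y \<in> \<mm>") (auto simp: less_le)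
    have minus_iff: "- x \<in> \<mm> \<longleftrightarrow> x \<in> \<mm>" for x
      using ideal_minus[of x] ideal_minus[of "- x"] by auto
    \<comment> \<open>The order yields the kernel: outside \<open>\<mm>\<close>, \<open>x\<close> is
      above or below 0 and \<open>strict\<close> separates the images.\<close>
    show "\<kappa> (?C x) = 0 \<longleftrightarrow> x \<in> \<mm>" if "x \<in> \<O>" for x
    proof (cases x "0 :: 'a" rule: linorder_cases)
      case less
      then show ?thesis
        using strict[of x 0] coset_eq[of x 0] that zero by (cases "x \<in> \<mm>") simp_all
    next
      case greater
      then show ?thesis
        using strict[of 0 x] coset_eq[of x 0] that zero minus_iff[of x]
        by (cases "x \<in> \<mm>") simp_all
    qed (use zero in simp)
  qed
qed

end

section \<open>Isolating an algebraic element by a polynomial\<close>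

text \<open>Induction along Horner's scheme, with
  \<open>\<bar>x\<bar> \<le> \<bar>r\<bar> + 1\<close>, replaces a compactness argument.\<close>

lemma poly_bounded_near:
  fixes p :: "'r::linordered_field Polynomial.poly"
  shows "\<exists>B. \<forall>x. \<bar>x - r\<bar> \<le> 1 \<longrightarrow> \<bar>Polynomial.poly p x\<bar> \<le> B"
proof (induction p)
  case (pCons a p)
  then obtain B where B: "\<And>x. \<bar>x - r\<bar> \<le> 1 \<Longrightarrow> \<bar>Polynomial.poly p x\<bar> \<le> B"
    by blast
  have "\<bar>Polynomial.poly (pCons a p) x\<bar> \<le> \<bar>a\<bar> + (\<bar>r\<bar> + 1) * B" if x: "\<bar>x - r\<bar> \<le> 1" for x
  proof -
    have "\<bar>x\<bar> \<le> \<bar>r\<bar> + 1"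
      using x by linarith
    then have "\<bar>x * Polynomial.poly p x\<bar> \<le> (\<bar>r\<bar> + 1) * B"
      unfolding abs_mult using B[OF x] by (intro mult_mono) auto
    then show ?thesis
      using abs_triangle_ineq[of a "x * Polynomial.poly p x"] by simp
  qed
  then show ?case
    by blast
qed auto

text \<open>In \<open>p(x) = p(r) + (x - r) * q(x)\<close> the factor \<open>q\<close> is bounded
  near \<open>r\<close>, so the second summand cannot cancel the first when \<open>x\<close> is
  close enough to \<open>r\<close>.\<close>

lemma poly_pos_near:
  fixes p :: "'r::linordered_field Polynomial.poly"
  assumes "0 < Polynomial.poly p r"
  obtains e where "0 < e" "\<And>x. \<bar>x - r\<bar> < e \<Longrightarrow> 0 < Polynomial.poly p x"
proof -
  have "Polynomial.poly (p - [:Polynomial.poly p r:]) r = 0"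
    by simp
  then obtain q where q: "p - [:Polynomial.poly p r:] = [:- r, 1:] * q"
    unfolding poly_eq_0_iff_dvd by (auto simp: dvd_def)
  have eq: "Polynomial.poly p x = Polynomial.poly p r + (x - r) * Polynomial.poly q x" for x
    using arg_cong[OF q, of "\<lambda>f. Polynomial.poly f x"] by (simp add: algebra_simps)
  obtain B where B: "\<And>x. \<bar>x - r\<bar> \<le> 1 \<Longrightarrow> \<bar>Polynomial.poly q x\<bar> \<le> B"
    using poly_bounded_near by blast
  define e where "e = min 1 (Polynomial.poly p r / (\<bar>B\<bar> + 1))"
  have "0 < Polynomial.poly p x" if x: "\<bar>x - r\<bar> < e" for x
  proof -
    have "\<bar>x - r\<bar> * \<bar>Polynomial.poly q x\<bar> \<le> \<bar>x - r\<bar> * (\<bar>B\<bar> + 1)"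
      using B[of x] x by (intro mult_left_mono) (auto simp: e_def)
    also have "\<dots> < Polynomial.poly p r"
      using x by (simp add: e_def pos_less_divide_eq add_nonneg_pos)
    finally have "\<bar>(x - r) * Polynomial.poly q x\<bar> < Polynomial.poly p r"
      by (simp add: abs_mult)
    then show ?thesis
      unfolding eq[of x] by (simp add: abs_less_iff)
  qed
  moreover have "0 < e"
    using assms by (simp add: e_def add_nonneg_pos)
  ultimately show thesis
    by (rule that[rotated])
qed

text \<open>A polynomial over \<open>k\<close> of minimal degree vanishing at \<open>r\<close> has a simple zero there, because its
  derivative is again a polynomial over \<open>k\<close>.\<close>

lemma algebraic_sign_change:
  fixes k :: "'r::linordered_field set"
  assumes "algebraic_over k r"
    and zero: "0 \<in> k" and add: "\<And>x y. x \<in> k \<Longrightarrow> y \<in> k \<Longrightarrow> x + y \<in> k"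
    and minus: "\<And>x. x \<in> k \<Longrightarrow> - x \<in> k"
  obtains f e where "\<And>i. Polynomial.coeff f i \<in> k" "0 < e"
    "\<And>x. \<bar>x - r\<bar> < e \<Longrightarrow> x < r \<Longrightarrow> Polynomial.poly f x < 0"
    "\<And>x. \<bar>x - r\<bar> < e \<Longrightarrow> r < x \<Longrightarrow> 0 < Polynomial.poly f x"
proof -
  let ?Q = "\<lambda>p. p \<noteq> 0 \<and> (\<forall>i. Polynomial.coeff p i \<in> k) \<and> Polynomial.poly p r = 0"
  obtain p where p: "?Q p" and minimal: "\<And>q. ?Q q \<Longrightarrow> Polynomial.degree p \<le> Polynomial.degree q"
    using assms(1) ex_has_least_nat[of ?Q _ Polynomial.degree] unfolding algebraic_over_def by blast
  \<comment> \<open>Coefficients of the derivative are natural multiples of those of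
    \<open>p\<close>, so additive closure keeps them in \<open>k\<close>.\<close>
  have multiple: "of_nat n * x \<in> k" if "x \<in> k" for n x
    using that by (induction n) (simp_all add: zero add algebra_simps)
  have degree: "Polynomial.degree p \<noteq> 0"
    using p by (metis degree_eq_zeroE pCons_0_0 poly_const_conv)
  have simple: "Polynomial.poly (pderiv p) r \<noteq> 0"
  proof
    assume "Polynomial.poly (pderiv p) r = 0"
    moreover have "\<forall>i. Polynomial.coeff (pderiv p) i \<in> k"
      using p multiple[of _ "Suc _"] by (auto simp: coeff_pderiv simp del: of_nat_Suc intro!: multiple)
    moreover have "pderiv p \<noteq> 0"
      using degree by (simp add: pderiv_eq_0_iff)
    ultimately show False
      using minimal[of "pderiv p"] degree by (simp add: degree_pderiv)
  qed
  define f where "f = (if 0 < Polynomial.poly (pderiv p) r then p else - p)"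
  have f: "Polynomial.poly f r = 0" "0 < Polynomial.poly (pderiv f) r" "Polynomial.coeff f i \<in> k" for i
    using p simple by (auto simp: f_def minus pderiv_minus)
  then obtain g where g: "f = [:- r, 1:] * g"
    unfolding poly_eq_0_iff_dvd by (auto simp: dvd_def)
  \<comment> \<open>By the product rule, the derivative of \<open>[:- r, 1:] * g\<close> at
    \<open>r\<close> is the value of \<open>g\<close> there.\<close>
  have "0 < Polynomial.poly g r"
    using f(2) unfolding g pderiv_mult by (simp add: pderiv_pCons)
  then obtain e where e: "0 < e" "\<And>x. \<bar>x - r\<bar> < e \<Longrightarrow> 0 < Polynomial.poly g x"
    using poly_pos_near by blast
  have eq: "Polynomial.poly f x = (x - r) * Polynomial.poly g x" for x
    by (simp add: g algebra_simps)
  show thesis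
    by (rule that[of f e]) (use f(3) e in \<open>simp_all add: eq mult_neg_pos\<close>)
qed

text \<open>The approximations might all lie on one side of \<open>r\<close>. The distance of two of
  them is a small positive \<open>s\<close> in \<open>k\<close>, and shifting a third one, closer to
  \<open>r\<close> than \<open>s\<close>, by \<open>s\<close> crosses \<open>r\<close>.\<close>

lemma two_sided_limit:
  fixes k :: "'r::linordered_field set"
  assumes add: "\<And>x y. x \<in> k \<Longrightarrow> y \<in> k \<Longrightarrow> x + y \<in> k" and minus: "\<And>x. x \<in> k \<Longrightarrow> - x \<in> k"
    and "r \<notin> k" and limit: "\<And>e. 0 < e \<Longrightarrow> \<exists>s\<in>k. r - e < s \<and> s < r + e" and "0 < e"
  obtains c d where "c \<in> k" "d \<in> k" "r - e < c" "c < r" "r < d" "d < r + e"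
proof -
  have diff: "x - y \<in> k" if "x \<in> k" "y \<in> k" for x y
    using add[OF that(1) minus[OF that(2)]] by simp
  have limit_abs: "\<exists>s\<in>k. \<bar>s - r\<bar> < e" if "0 < e" for e
    using limit[OF that] by (auto simp: abs_less_iff algebra_simps)
  obtain g where g: "g \<in> k" "\<bar>g - r\<bar> < e / 2"
    using limit_abs[of "e / 2"] \<open>0 < e\<close> by auto
  then have "g \<noteq> r"
    using \<open>r \<notin> k\<close> by blast
  \<comment> \<open>Being strictly closer to \<open>r\<close> than \<open>g\<close>, the element
    \<open>h\<close> differs from \<open>g\<close>.\<close>
  then obtain h where h: "h \<in> k" "\<bar>h - r\<bar> < \<bar>g - r\<bar>"
    using limit_abs[of "\<bar>g - r\<bar>"] by auto
  obtain s where s: "s \<in> k" "0 < s" "s < e"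
  proof (rule that[of "\<bar>g - h\<bar>"])
    show "\<bar>g - h\<bar> \<in> k"
      using g h diff by (auto simp: abs_if)
    show "0 < \<bar>g - h\<bar>"
      using h by auto
    show "\<bar>g - h\<bar> < e"
      using g(2) h(2) by linarith
  qed
  obtain t where t: "t \<in> k" "r - s < t" "t < r + s"
    using limit[OF s(2)] by blast
  then consider "t < r" | "r < t"
    using \<open>r \<notin> k\<close> by (metis linorder_neqE)
  then show thesis
  proof cases
    case 1
    show thesis
      by (rule that[of t "t + s"]) (use 1 s t in \<open>auto simp: add algebra_simps\<close>)
  next
    case 2
    show thesis
      by (rule that[of "t - s" t]) (use 2 s t in \<open>auto simp: diff algebra_simps\<close>)
  qed
qed

section \<open>The condition on the residue field\<close>

text \<open>The coefficients are parameters stored from variable 3 on, because variables 1 and 2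
  hold the interval ends \<open>C\<close> and \<open>D\<close>.\<close>

primrec poly_term :: "or_term \<Rightarrow> nat \<Rightarrow> or_term" where
  "poly_term t 0 = Zero"
| "poly_term t (Suc n) = Plus (poly_term t n) (Times (Var (3 + n)) (power_term t n))"

lemma term_value_poly_term [simp]:
  "term_value e (poly_term t n) = (\<Sum>i<n. e (3 + i) * term_value e t ^ i)"
  by (induction n) simp_all

lemma term_vars_poly_term: "term_vars (poly_term t n) \<subseteq> term_vars t \<union> {3..<3 + n}"
proof (induction n)
  case (Suc n)
  then show ?case
    using term_vars_power_term[of t n] by auto
qed simp

context convex_valued_field
begin

text \<open>Here \<open>L = {x. x < C \<or> x \<in> \<O> \<and> \<rho> x < r}\<close> is the lower cut of \<open>K\<close> at \<open>r\<close>. It equals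
  \<open>{x. x < C \<or> x \<le> D \<and> P x < 0}\<close> if the reduction of \<open>P\<close> goes from negative to positive at \<open>r\<close> and has
  no other zero between the residues of \<open>C\<close> and \<open>D\<close>.\<close>

lemma definable_if_residue_field_not_closed:
  fixes \<kappa> :: "'a set \<Rightarrow> 'r::{linordered_field, linorder_topology}"
  assumes closure: "is_real_closure (residue_field v) residue_less \<kappa>"
    and "\<not> closed (\<kappa> ` carrier (residue_field v))"
  shows "definable \<O>"
proof -
  obtain \<rho> :: "'a \<Rightarrow> 'r" where image: "\<rho> ` \<O> = \<kappa> ` carrier (residue_field v)" and \<rho>_1: "\<rho> 1 = 1"
    and \<rho>_add: "\<And>x y. x \<in> \<O> \<Longrightarrow> y \<in> \<O> \<Longrightarrow> \<rho> (x + y) = \<rho> x + \<rho> y"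
    and \<rho>_mult: "\<And>x y. x \<in> \<O> \<Longrightarrow> y \<in> \<O> \<Longrightarrow> \<rho> (x * y) = \<rho> x * \<rho> y"
    and \<rho>_mono: "\<And>x y. x \<in> \<O> \<Longrightarrow> y \<in> \<O> \<Longrightarrow> x \<le> y \<Longrightarrow> \<rho> x \<le> \<rho> y"
    and \<rho>_zero_iff: "\<And>x. x \<in> \<O> \<Longrightarrow> \<rho> x = 0 \<longleftrightarrow> x \<in> \<mm>"
    using residue_map[OF closure] by blast
  define k where "k = \<rho> ` \<O>"
  have \<rho>_0: "\<rho> 0 = 0"
    by (simp add: \<rho>_zero_iff)
  have \<rho>_minus: "\<rho> (- x) = - \<rho> x" if "x \<in> \<O>" for x
    using \<rho>_add[OF that ring_minus[OF that]] \<rho>_0 by (simp add: eq_neg_iff_add_eq_0 add.commute)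
  have \<rho>_diff: "\<rho> (x - y) = \<rho> x - \<rho> y" if "x \<in> \<O>" "y \<in> \<O>" for x y
    using \<rho>_add[of x "- y"] that by (simp add: \<rho>_minus ring_minus)
  have \<rho>_power: "\<rho> (x ^ n) = \<rho> x ^ n" if "x \<in> \<O>" for x n
    using that by (induction n) (simp_all add: \<rho>_1 \<rho>_mult ring_power)
  have \<rho>_sum: "\<rho> (\<Sum>i<n. h i) = (\<Sum>i<n. \<rho> (h i))" if "\<And>i. h i \<in> \<O>" for h and n :: nat
    using that by (induction n) (simp_all add: \<rho>_0 \<rho>_add ring_sum)
  have k_add: "x + y \<in> k" if "x \<in> k" "y \<in> k" for x y
    using that by (auto simp: k_def \<rho>_add[symmetric] ring_add)
  have k_minus: "- x \<in> k" if "x \<in> k" for x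
    using that by (auto simp: k_def \<rho>_minus[symmetric] ring_minus)
  have k_0: "0 \<in> k"
    unfolding k_def using \<rho>_0 ring_0 by (metis imageI)
  obtain r where r: "r \<notin> k" "\<And>e. 0 < e \<Longrightarrow> \<exists>s\<in>k. r - e < s \<and> s < r + e"
    using not_closed_limit[OF assms(2)] unfolding k_def image by blast
  have "algebraic_over k r"
    using closure by (simp add: is_real_closure_def k_def image)
  then obtain f e where f: "\<And>i. Polynomial.coeff f i \<in> k" and "0 < e"
    and f_neg: "\<And>x. \<bar>x - r\<bar> < e \<Longrightarrow> x < r \<Longrightarrow> Polynomial.poly f x < 0"
    and f_pos: "\<And>x. \<bar>x - r\<bar> < e \<Longrightarrow> r < x \<Longrightarrow> 0 < Polynomial.poly f x"
    using algebraic_sign_change[OF _ k_0 k_add k_minus] by blast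
  \<comment> \<open>Both ends are within \<open>e\<close> of \<open>r\<close>, where the sign of
    \<open>f\<close> is controlled.\<close>
  obtain c d where cd: "c \<in> k" "d \<in> k" "r - e < c" "c < r" "r < d" "d < r + e"
    using two_sided_limit[OF k_add k_minus r \<open>0 < e\<close>] by blast
  then obtain C D where C: "C \<in> \<O>" "\<rho> C = c" and D: "D \<in> \<O>" "\<rho> D = d"
    by (auto simp: k_def)
  have "\<forall>i. \<exists>y\<in>\<O>. \<rho> y = Polynomial.coeff f i"
    using f unfolding k_def by (metis imageE)
  then obtain a where a: "\<And>i. a i \<in> \<O>" "\<And>i. \<rho> (a i) = Polynomial.coeff f i"
    by metis
  define n where "n = Suc (Polynomial.degree f)"
  define P where "P x = (\<Sum>i<n. a i * x ^ i)" for x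
  have poly_f: "Polynomial.poly f y = (\<Sum>i<n. Polynomial.coeff f i * y ^ i)" for y
    by (simp add: poly_altdef n_def lessThan_Suc_atMost)
  have P: "P x \<in> \<O>" "\<rho> (P x) = Polynomial.poly f (\<rho> x)" if "x \<in> \<O>" for x
    using that by (simp_all add: P_def \<rho>_sum \<rho>_mult \<rho>_power a ring_sum ring_mult ring_power
        poly_f)
  define L where "L x \<longleftrightarrow> x < C \<or> x \<in> \<O> \<and> \<rho> x < r" for x
  have L_poly: "L x \<longleftrightarrow> x < C \<or> x \<le> D \<and> P x < 0" for x
  proof (cases "x < C \<or> D < x")
    case True
    moreover have "\<not> L x" if "C \<le> x" "D < x"
      using that \<rho>_mono[of D x] D cd by (force simp: L_def)
    ultimately show ?thesis
      by (force simp: L_def)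
  next
    case False
    then have x: "x \<in> \<O>" "c \<le> \<rho> x" "\<rho> x \<le> d"
      using ring_convex[of C D x] \<rho>_mono[of C x] \<rho>_mono[of x D] C D by auto
    have near: "\<bar>\<rho> x - r\<bar> < e"
      using x cd by (simp add: abs_less_iff)
    \<comment> \<open>Hence \<open>f\<close> is nonzero at \<open>\<rho> x\<close>, and
      \<open>P x\<close> has the sign of its residue whichever lifts \<open>a i\<close> were
      chosen.\<close>
    have "\<rho> x \<noteq> r"
      using r(1) x by (auto simp: k_def)
    then consider "\<rho> x < r" | "r < \<rho> x"
      by (metis linorder_neqE)
    then show ?thesis
    proof cases
      case 1
      then have "\<rho> (P x) < 0"
        using f_neg near P x by simp
      then have "P x < 0"
        using \<rho>_mono[of 0 "P x"] P x \<rho>_0 by force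
      then show ?thesis
        using 1 x False by (simp add: L_def)
    next
      case 2
      then have "0 < \<rho> (P x)"
        using f_pos near P x by simp
      then have "\<not> P x < 0"
        using \<rho>_mono[of "P x" 0] P x \<rho>_0 by force
      then show ?thesis
        using 2 x False by (simp add: L_def)
    qed
  qed
  have L_down: "L x" if "L y" "x \<le> y" for x y
  proof (cases "x < C \<or> y < C")
    case True
    then show ?thesis
      using that by (auto simp: L_def)
  next
    case False
    then have "y \<in> \<O>" "\<rho> y < r" "x \<in> \<O>"
      using that ring_convex[of C y x] C by (auto simp: L_def)
    then show ?thesis
      using \<rho>_mono[of x y] that by (auto simp: L_def)
  qed
  have L_ring: "L x \<longleftrightarrow> \<rho> x < r" if "x \<in> \<O>" for x
    using that \<rho>_mono[of x C] C cd by (auto simp: L_def)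
  have L_shift: "L (x + y)" if "L x" "y \<in> \<mm>" for x y
  proof (cases "x \<in> \<O>")
    case True
    then show ?thesis
      using that L_ring[of "x + y"] L_ring[of x] ideal_in_ring[of y] \<rho>_zero_iff[of y]
      by (simp add: ring_add \<rho>_add)
  \<comment> \<open>Outside \<open>\<O>\<close> there is no residue to compare, but \<open>x\<close>
    lies below \<open>C\<close>, and \<open>C + y\<close> is still in the cut.\<close>
  next
    case False
    then have "x < C"
      using that by (simp add: L_def)
    moreover have "L (C + y)"
      using that L_ring[of "C + y"] C cd ideal_in_ring[of y] \<rho>_zero_iff[of y]
      by (simp add: ring_add \<rho>_add)
    ultimately show ?thesis
      using L_down[of "C + y" "x + y"] by simp
  qed
  have ideal_iff: "y \<in> \<mm> \<longleftrightarrow> (\<forall>x. L x \<longrightarrow> L (x + y) \<and> L (x - y))" for y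
  proof
    show "\<forall>x. L x \<longrightarrow> L (x + y) \<and> L (x - y)" if "y \<in> \<mm>"
      using L_shift[of _ y] L_shift[of _ "- y"] ideal_minus[of y] that by auto
  next
    assume *: "\<forall>x. L x \<longrightarrow> L (x + y) \<and> L (x - y)"
    define z where "z = \<bar>y\<bar>"
    have z: "0 \<le> z" "\<And>x. L x \<Longrightarrow> L (x + z)"
      using * by (auto simp: z_def abs_if)
    \<comment> \<open>Shifting \<open>C\<close> bounds \<open>z\<close>: as \<open>C + z\<close> is
      in the cut but not below \<open>C\<close>, it belongs to \<open>\<O>\<close>.\<close>
    have "L C"
      using C cd by (simp add: L_ring)
    then have "L (C + z)"
      by (rule z(2))
    then have "C + z \<in> \<O>"
      using z(1) by (simp add: L_def)
    then have zO: "z \<in> \<O>"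
      using ring_diff[of "C + z" C] C by simp
    have "\<rho> z \<le> 0"
    proof (rule ccontr)
      assume "\<not> \<rho> z \<le> 0"
      \<comment> \<open>Two shifts by \<open>z\<close>, starting from \<open>u - z\<close> below the
        cut point, reach \<open>u + z\<close>, whose residue exceeds \<open>r\<close>.\<close>
      then obtain u where u: "u \<in> \<O>" "r - \<rho> z < \<rho> u" "\<rho> u < r + \<rho> z"
        using r(2)[of "\<rho> z"] by (auto simp: k_def)
      have "L (u - z)"
        using u zO by (simp add: L_ring ring_diff \<rho>_diff algebra_simps)
      then have "L u"
        using z(2)[of "u - z"] by simp
      then have "L (u + z)"
        by (rule z(2))
      then show False
        using u zO by (simp add: L_ring ring_add \<rho>_add algebra_simps)
    qed
    then have "\<rho> z = 0"
      using \<rho>_mono[of 0 z] z zO \<rho>_0 by simp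
    then have "z \<in> \<mm>"
      using \<rho>_zero_iff zO by simp
    then show "y \<in> \<mm>"
      using ideal_minus[of "- y"] by (auto simp: z_def abs_if split: if_splits)
  qed
  \<comment> \<open>The parameters \<open>C\<close>, \<open>D\<close> and the \<open>n\<close>
    coefficients occupy variables 1 to \<open>n + 2\<close>; the bound variables
    \<open>N + 1\<close> and \<open>N + 2\<close> come after them.\<close>
  define N where "N = n + 2"
  define p where "p i = (if i = 1 then C else if i = 2 then D else a (i - 3))" for i :: nat
  let ?y = "Var (N + 1)" and ?x = "Var (N + 2)"
  define A where "A t = Neg (Conj (Neg (Less t (Var 1)))
    (Neg (Conj (Neg (Less (Var 2) t)) (Less (poly_term t n) Zero))))" for t
  \<comment> \<open>The inner negated quantifier expresses \<open>y \<in> \<mm>\<close> through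
    \<open>ideal_iff\<close>; the outer one says that no such \<open>y\<close> is inverse to
    variable 0.\<close>
  define \<phi> where "\<phi> = Neg (Exists (N + 1) (Conj (Equal (Times (Var 0) ?y) One)
    (Neg (Exists (N + 2) (Conj (A ?x) (Neg (Conj (A (Plus ?x ?y)) (A (Minus ?x ?y)))))))))"
  have A: "satisfies (p(0 := z, N + 1 := y, N + 2 := x)) (A t)
    \<longleftrightarrow> L (term_value (p(0 := z, N + 1 := y, N + 2 := x)) t)" for z y x t
  proof -
    let ?e = "p(0 := z, N + 1 := y, N + 2 := x)"
    have "term_value ?e (poly_term t n) = P (term_value ?e t)"
      unfolding term_value_poly_term P_def by (intro sum.cong) (auto simp: p_def N_def)
    moreover have "?e 1 = C" "?e 2 = D"
      by (simp_all add: p_def N_def)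
    ultimately show ?thesis
      by (auto simp: A_def L_poly simp del: term_value_poly_term)
  qed
  have "free_vars (A t) \<subseteq> term_vars t \<union> {0..N}" for t
    using term_vars_poly_term[of t n] by (force simp: A_def N_def)
  from this[of ?x] this[of "Plus ?x ?y"] this[of "Minus ?x ?y"]
  have "free_vars \<phi> \<subseteq> {0..N}"
    by (fastforce simp: \<phi>_def)
  moreover have "satisfies (p(0 := z)) \<phi> \<longleftrightarrow> z \<in> \<O>" for z
    unfolding mem_ring_iff_no_inverse Bex_def ideal_iff by (auto simp: \<phi>_def A[simplified])
  ultimately have "definable_with_params N \<O>"
    by (rule definable_with_paramsI)
  then show ?thesis
    unfolding definable_def by blast
qed

end

theorem theorem3p1:
  fixes v :: "'a::linordered_field \<Rightarrow> 'g::linordered_ab_group_add"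
    and \<eta> :: "'g \<Rightarrow> 'd::{linordered_ab_group_add, linorder_topology}"
    and \<kappa> :: "'a set \<Rightarrow> 'r::{linordered_field, linorder_topology}"
  assumes "convex_valuation v"
    and "discretely_ordered (value_group v)
       \<or> (is_divisible_hull (value_group v) \<eta> \<and> \<not> closed (\<eta> ` value_group v))
       \<or> (is_real_closure (residue_field v) residue_less \<kappa>
            \<and> \<not> closed (\<kappa> ` carrier (residue_field v)))"
  shows "definable (valuation_ring v)
       \<and> (discretely_ordered (value_group v)
            \<or> (is_divisible_hull (value_group v) \<eta> \<and> \<not> closed (\<eta> ` value_group v))
          \<longrightarrow> definable_with_params 1 (valuation_ring v))"
proof -
  interpret convex_valued_field v
    using assms(1) by unfold_locales
  show ?thesis
    using assms(2) definable_if_discrete definable_if_value_group_not_closed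
      definable_if_residue_field_not_closed unfolding definable_def by blast
qed

end
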